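(* For the Klein quartic over $\mathbb{F}_8$, let $\tilde C(\delta)$ be the dual code of $\mathrm{Span}_{\mathbb{F}_8}\{\mathrm{ev}(M_i)\mid \mu_i<\delta\}$, with $M_i$ and $\mu_i$ as described in the context. Then $\tilde C(\delta)$ is a linear code over $\mathbb{F}_8$ of length $22$ whose dimension is $k$ and whose minimum distance is at least $\delta$, for each of the following pairs $(k,\delta)$: $$(21,2),\ (19,3),\ (17,4),\ (15,6),\ (12,8),\ (10,9),\ (9,11),\ (8,12),\ (6,14),\ (5,15),\ (3,17),\ (2,18),\ (1,21).$$
   Context: Let $\{P_1,\ldots,P_{22}\}\subseteq\mathbb{F}_8^2$ be the set of the 22 affine $\mathbb{F}_8$-rational zeros of the Klein quartic $Y^3+X^3Y+X$. For a polynomial $F\in\mathbb{F}_8[X,Y]$, $\mathrm{ev}(F)=(F(P_1),\ldots,F(P_{22}))\in\mathbb{F}_8^{22}$. The monomials are, in order, $M_1=1$, $M_2=X$, $M_3=Y$, $M_4=X^2$, $M_5=XY$, $M_6=X^3$, $M_7=Y^2$, $M_8=X^2Y$, $M_9=X^4$, $M_{10}=XY^2$, $M_{11}=X^3Y$, $M_{12}=X^5$, $M_{13}=X^2Y^2$, $M_{14}=X^4Y$, $M_{15}=X^6$, $M_{16}=X^3Y^2$, $M_{17}=X^5Y$, $M_{18}=X^7$, $M_{19}=X^4Y^2$, $M_{20}=X^6Y$, $M_{21}=X^5Y^2$, $M_{22}=X^6Y^2$. The associated integers are $(\mu_1,\ldots,\mu_{22})=(1,2,2,3,4,4,3,6,6,6,8,8,9,11,12,12,14,15,15,17,18,21)$.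 Duals are taken with respect to the standard bilinear form. *)

theory Defs
  imports
    "HOL-Analysis.Cartesian_Space"
    "HOL-Library.Numeral_Type"
    "HOL-Computational_Algebra.Polynomial"
begin

definition hamming_dist :: "'a ^ 'n \<Rightarrow> 'a ^ 'n \<Rightarrow> nat" where
  "hamming_dist v w = card {i. v $ i \<noteq> w $ i}"

text \<open>If the code has at most one word, the infimum is over the empty set and equals 0.\<close>

definition min_distance :: "('a ^ 'n) set \<Rightarrow> nat" where
  "min_distance C = Inf {hamming_dist v w | v w. v \<in> C \<and> w \<in> C \<and> v \<noteq> w}"

definition dual_code :: "('a::field ^ 'n) set \<Rightarrow> ('a ^ 'n) set" where
  "dual_code C = {v. \<forall>w\<in>C. scalar_product v w = 0}"

text \<open>A polynomial in two variables is represented in \<open>K[X][Y]\<close>: the outer variable is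
  \<open>Y\<close>, and the coefficients are polynomials in \<open>X\<close>.\<close>

definition varX :: "'a::field poly poly" where "varX = [:[:0, 1:]:]"

definition varY :: "'a::field poly poly" where "varY = [:0, 1:]"

definition eval2 :: "'a::field poly poly \<Rightarrow> 'a \<times> 'a \<Rightarrow> 'a" where
  "eval2 F p = poly (poly F [:snd p:]) (fst p)"

definition klein_quartic :: "'a::field poly poly" where
  "klein_quartic = varY ^ 3 + varX ^ 3 * varY + varX"

definition klein_zeros :: "('a::field \<times> 'a) set" where
  "klein_zeros = {p. eval2 klein_quartic p = 0}"

definition ev :: "('n \<Rightarrow> 'a::field \<times> 'a) \<Rightarrow> 'a poly poly \<Rightarrow> 'a ^ 'n" where
  "ev P F = (\<chi> j. eval2 F (P j))"

text \<open>The exponents \<open>(a, b)\<close> of the monomials \<open>M\<^sub>i = X\<^sup>a Y\<^sup>b\<close>. Both this list and the list of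
  the \<open>\<mu>\<^sub>i\<close> are meant to be indexed by \<open>i = 1, \<dots>, 22\<close>.\<close>

definition klein_exponents :: "(nat \<times> nat) list" where
  "klein_exponents =
    [(0,0), (1,0), (0,1), (2,0), (1,1), (3,0), (0,2), (2,1), (4,0), (1,2), (3,1),
     (5,0), (2,2), (4,1), (6,0), (3,2), (5,1), (7,0), (4,2), (6,1), (5,2), (6,2)]"

definition klein_monomial :: "nat \<Rightarrow> 'a::field poly poly" where
  "klein_monomial i =
    varX ^ fst (klein_exponents ! (i - 1)) * varY ^ snd (klein_exponents ! (i - 1))"

definition klein_mu :: "nat \<Rightarrow> nat" where
  "klein_mu i = [1,2,2,3,4,4,3,6,6,6,8,8,9,11,12,12,14,15,15,17,18,21] ! (i - 1)"

definition klein_code :: "('n \<Rightarrow> 'a::field \<times> 'a) \<Rightarrow> nat \<Rightarrow> ('a ^ 'n) set" where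
  "klein_code P \<delta> =
    dual_code (vec.span {ev P (klein_monomial i) | i. i \<in> {1..22} \<and> klein_mu i < \<delta>})"

end

(*
  Order bound with case distinctions. For a word c, let s(a,b) be the pairing of c with
  ev(X^a Y^b). The curve equation and x^8 = x let every s(a,b) be rewritten in terms of the
  syndromes of c, the 22 values at the M_i, and Lagrange interpolation shows that c is
  determined by them. This gives the dimensions. For the distance, the matrix with entries
  s(M_j M_k) factors through the support of c, so its rank is at most the weight of c. If M_i
  is the first monomial with nonzero syndrome, this matrix has a triangular submatrix of size
  mu_i. When the later syndromes influence the shape of the matrix, a different submatrix is
  used according to whether X^7, X^6 Y, X^6 Y^2, ... have zero syndrome or not.
*)

theory Submission
  imports Defs
begin

text \<open>The pairs list the rows and columns of a lower triangular submatrix with nonzero diagonal.\<close>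

primrec staircase :: "('i \<Rightarrow> 'j \<Rightarrow> 'a::zero) \<Rightarrow> ('i \<times> 'j) list \<Rightarrow> bool" where
  "staircase A [] \<longleftrightarrow> True"
| "staircase A (p # L) \<longleftrightarrow>
    A (fst p) (snd p) \<noteq> 0 \<and> (\<forall>q\<in>set L. A (fst p) (snd q) = 0) \<and> staircase A L"

section \<open>Orthogonality and the rank bound for the weight of a word\<close>

lemma scalar_product_add_right:
  "scalar_product u (v + w) = scalar_product u v + scalar_product u w"
  by (simp add: scalar_product_def distrib_left sum.distrib)

lemma scalar_product_add_left:
  "scalar_product (u + v) w = scalar_product u w + scalar_product v w"
  by (simp add: scalar_product_def distrib_right sum.distrib)

lemma scalar_product_scale_right:
  "scalar_product u (a *s v) = a * scalar_product u v" for a :: "'a::field"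
  by (simp add: scalar_product_def sum_distrib_left mult.left_commute)

lemma scalar_product_scale_left:
  "scalar_product (a *s u) v = a * scalar_product u v" for a :: "'a::field"
  by (simp add: scalar_product_def sum_distrib_left mult.assoc)

lemma subspace_orthogonal: "vec.subspace {w. scalar_product u w = 0}"
  by (rule vec.subspaceI)
    (auto simp: scalar_product_add_right scalar_product_scale_right, simp add: scalar_product_def)

lemma scalar_product_span_eq_0:
  assumes "w \<in> vec.span S" and "\<And>v. v \<in> S \<Longrightarrow> scalar_product u v = 0"
  shows "scalar_product u w = 0"
  using vec.span_minimal[OF _ subspace_orthogonal, of S u] assms by blast

text \<open>The matrix entries are pairings of \<open>f i\<close> with the vectors
  \<open>w j\<close>, the products of \<open>g j\<close> with \<open>c\<close>. For each pair of the
  staircase, pairing with its row vector kills all later \<open>w j\<close> but not its own, so the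
  \<open>w j\<close> of the list are independent. All of them live on the support of
  \<open>c\<close>, whose coordinate subspace has the size of the support as its dimension.\<close>

lemma length_le_card_support_if_staircase:
  fixes c :: "'a::field ^ 'n" and f :: "'i \<Rightarrow> 'a ^ 'n" and g :: "'j \<Rightarrow> 'a ^ 'n"
  assumes "staircase (\<lambda>i j. \<Sum>p\<in>UNIV. c $ p * (f i $ p * g j $ p)) L"
  shows "length L \<le> card {p. c $ p \<noteq> 0}"
proof -
  define w where "w j = (\<chi> p. c $ p * g j $ p)" for j
  have A: "(\<Sum>p\<in>UNIV. c $ p * (f i $ p * g j $ p)) = scalar_product (f i) (w j)" for i j
    by (simp add: scalar_product_def w_def ac_simps)
  have indep: "vec.independent (w ` snd ` set L) \<and> card (w ` snd ` set L) = length L"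
    using assms
  proof (induction L)
    case (Cons p L)
    let ?W = "w ` snd ` set L"
    from Cons have IH: "vec.independent ?W" "card ?W = length L"
      and nz: "scalar_product (f (fst p)) (w (snd p)) \<noteq> 0"
      and z: "\<And>v. v \<in> ?W \<Longrightarrow> scalar_product (f (fst p)) v = 0"
      by (auto simp: A)
    have "w (snd p) \<notin> vec.span ?W"
      using scalar_product_span_eq_0 z nz by blast
    then show ?case
      using IH vec.span_base[of "w (snd p)" ?W] by (auto simp: vec.independent_insert)
  qed (simp add: vec.independent_empty)
  define S where "S = {p. c $ p \<noteq> 0}"
  have "w ` snd ` set L \<subseteq> {x. \<forall>p. p \<notin> S \<longrightarrow> x $ p = 0}"
    by (auto simp: w_def S_def)
  then have "card (w ` snd ` set L) \<le> vec.dim {x :: 'a ^ 'n. \<forall>p. p \<notin> S \<longrightarrow> x $ p = 0}"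
    using indep by (blast intro: vec.independent_card_le_dim)
  also have "\<dots> = card S"
    by (rule dim_substandard_cart)
  finally show ?thesis
    using indep by (simp add: S_def)
qed

section \<open>Moments of a word, exponents of the monomials, and the Frobenius identity\<close>

definition moment :: "('n \<Rightarrow> 'a::field \<times> 'a) \<Rightarrow> 'a ^ 'n \<Rightarrow> nat \<Rightarrow> nat \<Rightarrow> 'a" where
  "moment P c a b = (\<Sum>p\<in>UNIV. c $ p * (fst (P p) ^ a * snd (P p) ^ b))"

definition klein_exp :: "nat \<Rightarrow> nat \<times> nat" where
  "klein_exp i = klein_exponents ! (i - 1)"

text \<open>The entry of the matrix indexed by monomials: \<open>s\<close> at the exponents of \<open>M\<^sub>j M\<^sub>k\<close>.\<close>

definition at_product :: "(nat \<Rightarrow> nat \<Rightarrow> 'a) \<Rightarrow> nat \<Rightarrow> nat \<Rightarrow> 'a" where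
  "at_product s j k =
    s (fst (klein_exp j) + fst (klein_exp k)) (snd (klein_exp j) + snd (klein_exp k))"

lemma length_klein_exponents: "length klein_exponents = 22"
  by (simp add: klein_exponents_def)

lemma klein_exp_simps:
  "klein_exp 1 = (0,0)" "klein_exp 2 = (1,0)" "klein_exp 3 = (0,1)" "klein_exp 4 = (2,0)"
  "klein_exp 5 = (1,1)" "klein_exp 6 = (3,0)" "klein_exp 7 = (0,2)" "klein_exp 8 = (2,1)"
  "klein_exp 9 = (4,0)" "klein_exp 10 = (1,2)" "klein_exp 11 = (3,1)" "klein_exp 12 = (5,0)"
  "klein_exp 13 = (2,2)" "klein_exp 14 = (4,1)" "klein_exp 15 = (6,0)" "klein_exp 16 = (3,2)"
  "klein_exp 17 = (5,1)" "klein_exp 18 = (7,0)" "klein_exp 19 = (4,2)" "klein_exp 20 = (6,1)"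
  "klein_exp 21 = (5,2)" "klein_exp 22 = (6,2)"
  by (simp_all add: klein_exp_def klein_exponents_def)

lemma eval2_klein_monomial:
  "eval2 (klein_monomial i) p = fst p ^ fst (klein_exp i) * snd p ^ snd (klein_exp i)"
  by (simp add: eval2_def klein_monomial_def klein_exp_def varX_def varY_def)

text \<open>Multiplication by a nonzero \<open>x\<close> permutes the nonzero elements, so it leaves
  their product unchanged.\<close>

lemma power_CARD_eq_same:
  fixes x :: "'a::{field,finite}"
  shows "x ^ CARD('a) = x"
proof (cases "x = 0")
  case False
  let ?U = "UNIV - {0::'a}"
  have "\<Prod>?U \<noteq> 0"
    by simp
  moreover have "(\<Prod>y\<in>?U. x * y) = \<Prod>?U"
    using False by (intro prod.reindex_bij_witness[of _ "\<lambda>y. y / x" "\<lambda>y. x * y"]) auto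
  ultimately have "x ^ (CARD('a) - 1) = 1"
    by (simp add: prod.distrib)
  then show ?thesis
    using zero_less_card_finite[where 'a = 'a]
    by (metis One_nat_def Suc_pred mult.right_neutral power_Suc)
qed simp

section \<open>Reduction of all moments to the 22 syndromes, and their elimination\<close>

locale klein_moments =
  fixes s :: "nat \<Rightarrow> nat \<Rightarrow> 'a::field"
  assumes X8: "8 \<le> a \<Longrightarrow> s a b = s (a - 7) b"
    and X7: "7 \<le> a \<Longrightarrow> 1 \<le> b \<Longrightarrow> s a b = s (a - 7) b"
    and Y3: "3 \<le> b \<Longrightarrow> s a b = - s (a + 3) (b - 2) - s (a + 1) (b - 3)"
begin

text \<open>\<open>Y3\<close> lowers b but raises a, hence the outer induction on b with arbitrary
  a; for b below 3, \<open>X8\<close> and \<open>X7\<close> lower a. What remains is the box a < 7,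
  b < 3 together with (7,0), which are the 22 listed exponents.\<close>

lemma eq_0_if_klein_exp_eq_0:
  assumes "\<And>i. i \<in> {1..22} \<Longrightarrow> s (fst (klein_exp i)) (snd (klein_exp i)) = 0"
  shows "s a b = 0"
proof (induction b arbitrary: a rule: less_induct)
  case (less b)
  show ?case
  proof (cases "3 \<le> b")
    case True
    then show ?thesis
      by (simp add: Y3 less)
  next
    case b: False
    show ?thesis
    proof (induction a rule: less_induct)
      case (less a)
      have *: "\<exists>i\<in>{1..22}. klein_exp i = (a, b)" if "a \<le> 6 \<or> a = 7 \<and> b = 0"
      proof -
        have "(a, b) \<in> set klein_exponents"
        proof -
          have "\<forall>a\<in>{..<7}. \<forall>b\<in>{..<3}. (a, b) \<in> set klein_exponents"
            by (simp add: klein_exponents_def lessThan_nat_numeral lessThan_Suc)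
          moreover have "(7, 0) \<in> set klein_exponents"
            by (simp add: klein_exponents_def)
          moreover have "a \<in> {..<7} \<and> b \<in> {..<3} \<or> (a, b) = (7, 0)"
            using b that by auto
          ultimately show ?thesis by metis
        qed
        then obtain i where "i < 22" "klein_exponents ! i = (a, b)"
          by (metis in_set_conv_nth length_klein_exponents)
        then show ?thesis
          by (intro bexI[of _ "Suc i"]) (auto simp: klein_exp_def)
      qed
      consider "a \<le> 6 \<or> a = 7 \<and> b = 0" | "a = 7" "1 \<le> b" | "8 \<le> a" by linarith
      then show ?case
      proof cases
        case 1
        then show ?thesis using * assms by (metis fst_conv snd_conv)
      next
        case 2
        then show ?thesis using less[of 0] by (simp add: X7)
      next
        case 3
        then show ?thesis using less[of "a - 7"] by (simp add: X8[of a])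
      qed
    qed
  qed
qed

lemmas klein_simps = klein_exp_simps at_product_def klein_mu_def X8 X7 Y3

text \<open>The lists below were found by a computer search for large triangular submatrices.
  Rewriting with \<open>X8\<close>, \<open>X7\<close> and \<open>Y3\<close> expresses every matrix entry through the 22 syndromes;
  this needs the exponents to stay numerals, not \<open>Suc\<close> terms.\<close>

lemma eq_0_if_staircases_short:
  assumes short: "\<And>i L. i \<in> {1..22} \<Longrightarrow> s (fst (klein_exp i)) (snd (klein_exp i)) \<noteq> 0 \<Longrightarrow>
    staircase (at_product s) L \<Longrightarrow> length L < klein_mu i"
  shows "s a b = 0"
proof -
  have no: False if "i \<in> {1..22}" "s (fst (klein_exp i)) (snd (klein_exp i)) \<noteq> 0"
    "staircase (at_product s) L" "klein_mu i \<le> length L" for i L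
    using short[OF that(1-3)] that(4) by simp
  \<comment> \<open>The syndromes are eliminated in the order of the monomials, \<open>z\<close>
    collecting those known to vanish. If \<open>klein_mu i\<close> is the number of monomials
    dividing M_i, the pairs are all factorisations M_j M_k = M_i, and every pivot is the syndrome at
    M_i. That number falls short only for i = 9, 12, 14, 15, 17, 18, 20; there, pivots also come
    from later syndromes or from other products that reduce to M_i.\<close>
  have z1: "s 0 0 = 0"
  proof (rule ccontr)
    assume n1: "s 0 0 \<noteq> 0"
    show False
      by (rule no[of 1 "[(1,1)]"])
        (simp_all add: n1 klein_simps del: add_2_eq_Suc add_2_eq_Suc' flip: One_nat_def)
  qed
  note z = z1
  have z2: "s 1 0 = 0"
  proof (rule ccontr)
    assume n2: "s 1 0 \<noteq> 0"
    show False
      by (rule no[of 2 "[(1,2),(2,1)]"])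
        (simp_all add: z n2 klein_simps del: add_2_eq_Suc add_2_eq_Suc' flip: One_nat_def)
  qed
  note z = z z2
  have z3: "s 0 1 = 0"
  proof (rule ccontr)
    assume n3: "s 0 1 \<noteq> 0"
    show False
      by (rule no[of 3 "[(1,3),(3,1)]"])
        (simp_all add: z n3 klein_simps del: add_2_eq_Suc add_2_eq_Suc' flip: One_nat_def)
  qed
  note z = z z3
  have z4: "s 2 0 = 0"
  proof (rule ccontr)
    assume n4: "s 2 0 \<noteq> 0"
    show False
      by (rule no[of 4 "[(1,4),(2,2),(4,1)]"])
        (simp_all add: z n4 klein_simps del: add_2_eq_Suc add_2_eq_Suc' flip: One_nat_def)
  qed
  note z = z z4
  have z5: "s 1 1 = 0"
  proof (rule ccontr)
    assume n5: "s 1 1 \<noteq> 0"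
    show False
      by (rule no[of 5 "[(1,5),(2,3),(3,2),(5,1)]"])
        (simp_all add: z n5 klein_simps del: add_2_eq_Suc add_2_eq_Suc' flip: One_nat_def)
  qed
  note z = z z5
  have z6: "s 3 0 = 0"
  proof (rule ccontr)
    assume n6: "s 3 0 \<noteq> 0"
    show False
      by (rule no[of 6 "[(1,6),(2,4),(4,2),(6,1)]"])
        (simp_all add: z n6 klein_simps del: add_2_eq_Suc add_2_eq_Suc' flip: One_nat_def)
  qed
  note z = z z6
  have z7: "s 0 2 = 0"
  proof (rule ccontr)
    assume n7: "s 0 2 \<noteq> 0"
    show False
      by (rule no[of 7 "[(1,7),(3,3),(7,1)]"])
        (simp_all add: z n7 klein_simps del: add_2_eq_Suc add_2_eq_Suc' flip: One_nat_def)
  qed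
  note z = z z7
  have z8: "s 2 1 = 0"
  proof (rule ccontr)
    assume n8: "s 2 1 \<noteq> 0"
    show False
      by (rule no[of 8 "[(1,8),(2,5),(3,4),(4,3),(5,2),(8,1)]"])
        (simp_all add: z n8 klein_simps del: add_2_eq_Suc add_2_eq_Suc' flip: One_nat_def)
  qed
  note z = z z8
  have z9: "s 4 0 = 0"
  proof (rule ccontr)
    assume n9: "s 4 0 \<noteq> 0"
    \<comment> \<open>X^4 has five divisors, but six pivots are needed. X^6 Y^3 reduces to -X^7 -
      X^2 Y, so a nonzero syndrome at X^7 supplies \<open>(18,1)\<close> and
      \<open>(22,3)\<close>.\<close>
    have z18: "s 7 0 = 0"
    proof (rule ccontr)
      assume n18: "s 7 0 \<noteq> 0"
      show False
        by (rule no[of 9 "[(1,9),(18,1),(2,6),(4,4),(22,3),(6,2)]"])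
          (simp_all add: z n9 n18 klein_simps del: add_2_eq_Suc add_2_eq_Suc' flip: One_nat_def)
    qed
    have z15: "s 6 0 = 0"
    proof (rule ccontr)
      assume n15: "s 6 0 \<noteq> 0"
      have z22: "s 6 2 = 0"
      proof (rule ccontr)
        assume n22: "s 6 2 \<noteq> 0"
        show False
          by (rule no[of 9 "[(4,4),(5,17),(6,2),(7,15),(3,20),(15,1)]"])
            (simp_all add: z n9 z18 n15 n22 klein_simps
              del: add_2_eq_Suc add_2_eq_Suc' flip: One_nat_def)
      qed
      show False
        by (rule no[of 9 "[(4,9),(6,2),(5,19),(7,17),(1,15),(9,18)]"])
          (simp_all add: z n9 z18 n15 z22 klein_simps
            del: add_2_eq_Suc add_2_eq_Suc' flip: One_nat_def)
    qed
    \<comment> \<open>Exponents wrap around: X^11 reduces to X^4, so \<open>(9,18)\<close> and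
      \<open>(12,15)\<close> join four factorisations of X^4.\<close>
    show False
      by (rule no[of 9 "[(1,9),(2,6),(4,4),(6,2),(9,18),(12,15)]"])
        (simp_all add: z n9 z18 z15 klein_simps del: add_2_eq_Suc add_2_eq_Suc' flip: One_nat_def)
  qed
  note z = z z9
  have z10: "s 1 2 = 0"
  proof (rule ccontr)
    assume n10: "s 1 2 \<noteq> 0"
    show False
      by (rule no[of 10 "[(1,10),(2,7),(3,5),(5,3),(7,2),(10,1)]"])
        (simp_all add: z n10 klein_simps del: add_2_eq_Suc add_2_eq_Suc' flip: One_nat_def)
  qed
  note z = z z10
  have z11: "s 3 1 = 0"
  proof (rule ccontr)
    assume n11: "s 3 1 \<noteq> 0"
    show False
      by (rule no[of 11 "[(1,11),(2,8),(3,6),(4,5),(5,4),(6,3),(8,2),(11,1)]"])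
        (simp_all add: z n11 klein_simps del: add_2_eq_Suc add_2_eq_Suc' flip: One_nat_def)
  qed
  note z = z z11
  have z12: "s 5 0 = 0"
  proof (rule ccontr)
    assume n12: "s 5 0 \<noteq> 0"
    have z13: "s 2 2 = 0"
    proof (rule ccontr)
      assume n13: "s 2 2 \<noteq> 0"
      show False
        by (rule no[of 12 "[(1,13),(2,9),(3,8),(4,6),(5,5),(6,4),(8,3),(9,2)]"])
          (simp_all add: z n12 n13 klein_simps del: add_2_eq_Suc add_2_eq_Suc' flip: One_nat_def)
    qed
    have z14: "s 4 1 = 0"
    proof (rule ccontr)
      assume n14: "s 4 1 \<noteq> 0"
      show False
        by (rule no[of 12 "[(1,12),(2,11),(3,10),(4,8),(5,7),(7,5),(6,4),(10,3)]"])
          (simp_all add: z n12 z13 n14 klein_simps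
            del: add_2_eq_Suc add_2_eq_Suc' flip: One_nat_def)
    qed
    have z17: "s 5 1 = 0"
    proof (rule ccontr)
      assume n17: "s 5 1 \<noteq> 0"
      show False
        by (rule no[of 12 "[(1,17),(2,14),(4,11),(7,8),(6,4),(10,5),(9,2),(13,3)]"])
          (simp_all add: z n12 z13 z14 n17 klein_simps
            del: add_2_eq_Suc add_2_eq_Suc' flip: One_nat_def)
    qed
    \<comment> \<open>X^4 Y^3 reduces to -X^5 - Y, so \<open>(3,19)\<close> and
      \<open>(19,3)\<close> join the six factorisations of X^5.\<close>
    show False
      by (rule no[of 12 "[(3,19),(1,12),(2,9),(4,6),(6,4),(9,2),(12,1),(19,3)]"])
        (simp_all add: z n12 z13 z14 z17 klein_simps
          del: add_2_eq_Suc add_2_eq_Suc' flip: One_nat_def)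
  qed
  note z = z z12
  have z13: "s 2 2 = 0"
  proof (rule ccontr)
    assume n13: "s 2 2 \<noteq> 0"
    show False
      by (rule no[of 13 "[(1,13),(2,10),(3,8),(4,7),(5,5),(7,4),(8,3),(10,2),(13,1)]"])
        (simp_all add: z n13 klein_simps del: add_2_eq_Suc add_2_eq_Suc' flip: One_nat_def)
  qed
  note z = z z13
  have z14: "s 4 1 = 0"
  proof (rule ccontr)
    assume n14: "s 4 1 \<noteq> 0"
    have z18: "s 7 0 = 0"
    proof (rule ccontr)
      assume n18: "s 7 0 \<noteq> 0"
      show False
        by (rule no[of 14 "[(1,14),(18,1),(2,11),(3,10),(4,8),(22,3),(20,7),(5,6),(6,5),(8,4),
          (11,2)]"])
          (simp_all add: z n14 n18 klein_simps del: add_2_eq_Suc add_2_eq_Suc' flip: One_nat_def)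
    qed
    have z22: "s 6 2 = 0"
    proof (rule ccontr)
      assume n22: "s 6 2 \<noteq> 0"
      show False
        by (rule no[of 14 "[(12,10),(9,13),(11,11),(6,16),(13,9),(8,14),(4,19),(10,12),(5,17),
          (7,15),(14,1)]"])
          (simp_all add: z n14 z18 n22 klein_simps
            del: add_2_eq_Suc add_2_eq_Suc' flip: One_nat_def)
    qed
    have z20: "s 6 1 = 0"
    proof (rule ccontr)
      assume n20: "s 6 1 \<noteq> 0"
      show False
        by (rule no[of 14 "[(1,20),(2,11),(3,10),(4,8),(22,22),(5,6),(6,5),(8,4),(9,3),(11,2),
          (14,18)]"])
          (simp_all add: z n14 z18 z22 n20 klein_simps
            del: add_2_eq_Suc add_2_eq_Suc' flip: One_nat_def)
    qed
    \<comment> \<open>Eight factorisations of X^4 Y are joined by \<open>(5,7)\<close>, as X Y^3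
      reduces to -X^4 Y - X^2, and by two pairs with product X^11 Y, which reduces to X^4 Y.\<close>
    show False
      by (rule no[of 14 "[(1,14),(2,11),(3,9),(4,8),(5,7),(6,5),(8,4),(9,3),(11,2),(12,20),
        (14,18)]"])
        (simp_all add: z n14 z18 z22 z20 klein_simps
          del: add_2_eq_Suc add_2_eq_Suc' flip: One_nat_def)
  qed
  note z = z z14
  have z15: "s 6 0 = 0"
  proof (rule ccontr)
    assume n15: "s 6 0 \<noteq> 0"
    have z18: "s 7 0 = 0"
    proof (rule ccontr)
      assume n18: "s 7 0 \<noteq> 0"
      show False
        by (rule no[of 15 "[(1,15),(18,1),(2,12),(20,7),(15,2),(21,5),(17,10),(12,4),(19,8),
          (9,6),(16,11),(4,9)]"])
          (simp_all add: z n15 n18 klein_simps del: add_2_eq_Suc add_2_eq_Suc' flip: One_nat_def)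
    qed
    have z22: "s 6 2 = 0"
    proof (rule ccontr)
      assume n22: "s 6 2 \<noteq> 0"
      show False
        by (rule no[of 15 "[(12,10),(9,13),(11,11),(6,16),(13,9),(8,14),(4,19),(10,12),(5,17),
          (7,15),(3,20),(15,18)]"])
          (simp_all add: z n15 z18 n22 klein_simps
            del: add_2_eq_Suc add_2_eq_Suc' flip: One_nat_def)
    qed
    have z20: "s 6 1 = 0"
    proof (rule ccontr)
      assume n20: "s 6 1 \<noteq> 0"
      show False
        by (rule no[of 15 "[(1,15),(2,12),(4,9),(22,22),(20,1),(15,3),(21,7),(17,2),(12,5),
          (14,4),(9,8),(6,6)]"])
          (simp_all add: z n15 z18 z22 n20 klein_simps
            del: add_2_eq_Suc add_2_eq_Suc' flip: One_nat_def)
    qed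
    \<comment> \<open>Six pairs factor X^6. The other six have product X^5 Y^3 or X^12 Y^3, and both
      reduce to -X^6 - X Y.\<close>
    show False
      by (rule no[of 15 "[(1,15),(2,12),(20,22),(15,1),(21,3),(17,7),(12,2),(19,5),(14,10),
        (9,4),(16,8),(6,6)]"])
        (simp_all add: z n15 z18 z22 z20 klein_simps
          del: add_2_eq_Suc add_2_eq_Suc' flip: One_nat_def)
  qed
  note z = z z15
  have z16: "s 3 2 = 0"
  proof (rule ccontr)
    assume n16: "s 3 2 \<noteq> 0"
    show False
      by (rule no[of 16 "[(1,16),(2,13),(3,11),(4,10),(5,8),(6,7),(7,6),(8,5),(10,4),(11,3),
        (13,2),(16,1)]"])
        (simp_all add: z n16 klein_simps del: add_2_eq_Suc add_2_eq_Suc' flip: One_nat_def)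
  qed
  note z = z z16
  have z17: "s 5 1 = 0"
  proof (rule ccontr)
    assume n17: "s 5 1 \<noteq> 0"
    have z18: "s 7 0 = 0"
    proof (rule ccontr)
      assume n18: "s 7 0 \<noteq> 0"
      show False
        by (rule no[of 17 "[(1,17),(18,1),(2,15),(3,12),(4,11),(22,3),(20,7),(15,2),(21,5),
          (17,10),(5,9),(6,8),(8,6),(11,4)]"])
          (simp_all add: z n17 n18 klein_simps del: add_2_eq_Suc add_2_eq_Suc' flip: One_nat_def)
    qed
    have z20: "s 6 1 = 0"
    proof (rule ccontr)
      assume n20: "s 6 1 \<noteq> 0"
      have z22: "s 6 2 = 0"
      proof (rule ccontr)
        assume n22: "s 6 2 \<noteq> 0"
        show False
          by (rule no[of 17 "[(9,8),(12,3),(6,16),(11,4),(13,9),(8,14),(4,19),(10,12),(5,17),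
            (2,21),(7,15),(14,2),(3,20),(20,1)]"])
            (simp_all add: z n17 z18 n20 n22 klein_simps
              del: add_2_eq_Suc add_2_eq_Suc' flip: One_nat_def)
      qed
      show False
        by (rule no[of 17 "[(18,20),(15,3),(12,5),(9,8),(11,6),(14,2),(16,13),(13,16),(2,14),
          (6,11),(8,9),(5,12),(3,15),(17,1)]"])
          (simp_all add: z n17 z18 n20 z22 klein_simps
            del: add_2_eq_Suc add_2_eq_Suc' flip: One_nat_def)
    qed
    \<comment> \<open>X^12 Y reduces to X^5 Y, so \<open>(15,20)\<close> and \<open>(20,15)\<close>
      join the twelve factorisations of X^5 Y.\<close>
    show False
      by (rule no[of 17 "[(12,3),(15,20),(1,17),(20,15),(2,14),(6,8),(4,11),(3,12),(8,6),(5,9),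
        (9,5),(11,4),(14,2),(17,1)]"])
        (simp_all add: z n17 z18 z20 klein_simps
          del: add_2_eq_Suc add_2_eq_Suc' flip: One_nat_def)
  qed
  note z = z z17
  \<comment> \<open>Eight pairs factor X^7 and seven factor X^6 Y^3, which reduces to -X^7 - X^2 Y.
    No case distinction is needed.\<close>
  have z18: "s 7 0 = 0"
  proof (rule ccontr)
    assume n18: "s 7 0 \<noteq> 0"
    show False
      by (rule no[of 18 "[(1,18),(18,1),(2,15),(20,7),(15,2),(21,5),(17,10),(12,4),(19,8),
        (14,13),(9,6),(16,11),(6,9),(13,14),(4,12)]"])
        (simp_all add: z n18 klein_simps del: add_2_eq_Suc add_2_eq_Suc' flip: One_nat_def)
  qed
  note z = z z18
  have z19: "s 4 2 = 0"
  proof (rule ccontr)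
    assume n19: "s 4 2 \<noteq> 0"
    show False
      by (rule no[of 19 "[(1,19),(2,16),(3,14),(4,13),(5,11),(6,10),(7,9),(8,8),(9,7),(10,6),
        (11,5),(13,4),(14,3),(16,2),(19,1)]"])
        (simp_all add: z n19 klein_simps del: add_2_eq_Suc add_2_eq_Suc' flip: One_nat_def)
  qed
  note z = z z19
  have z20: "s 6 1 = 0"
  proof (rule ccontr)
    assume n20: "s 6 1 \<noteq> 0"
    have z22: "s 6 2 = 0"
    proof (rule ccontr)
      assume n22: "s 6 2 \<noteq> 0"
      show False
        by (rule no[of 20 "[(15,3),(1,20),(12,10),(17,2),(19,4),(14,8),(9,13),(16,6),(11,11),
          (6,16),(13,9),(8,14),(4,19),(2,17),(10,12),(7,15),(22,18)]"])
          (simp_all add: z n20 n22 klein_simps del: add_2_eq_Suc add_2_eq_Suc' flip: One_nat_def)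
    qed
    \<comment> \<open>Thirteen factorisations of X^6 Y are joined by \<open>(18,20)\<close>, as X^13
      Y reduces to X^6 Y, and by three pairs with product X^5 Y^4, which reduces to -X^6 Y - X
      Y^2.\<close>
    show False
      by (rule no[of 20 "[(15,3),(12,5),(6,11),(14,4),(17,2),(18,20),(19,10),(9,8),(8,9),(11,6),
        (13,16),(4,14),(5,12),(10,19),(2,17),(3,15),(20,1)]"])
        (simp_all add: z n20 z22 klein_simps del: add_2_eq_Suc add_2_eq_Suc' flip: One_nat_def)
  qed
  note z = z z20
  have z21: "s 5 2 = 0"
  proof (rule ccontr)
    assume n21: "s 5 2 \<noteq> 0"
    show False
      by (rule no[of 21 "[(1,21),(2,19),(4,16),(6,13),(9,10),(12,7),(3,17),(5,14),(8,11),(11,8),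
        (14,5),(17,3),(7,12),(10,9),(13,6),(16,4),(19,2),(21,1)]"])
        (simp_all add: z n21 klein_simps del: add_2_eq_Suc add_2_eq_Suc' flip: One_nat_def)
  qed
  note z = z z21
  have z22: "s 6 2 = 0"
  proof (rule ccontr)
    assume n22: "s 6 2 \<noteq> 0"
    show False
      by (rule no[of 22 "[(1,22),(2,21),(3,20),(4,19),(5,17),(6,16),(7,15),(8,14),(9,13),
        (10,12),(11,11),(12,10),(13,9),(14,8),(15,7),(16,6),(17,5),(19,4),(20,3),(21,2),(22,1)]"])
        (simp_all add: z n22 klein_simps del: add_2_eq_Suc add_2_eq_Suc' flip: One_nat_def)
  qed
  note z = z z22
  show ?thesis
  proof (rule eq_0_if_klein_exp_eq_0)
    fix i :: nat
    assume "i \<in> {1..22}"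
    then have "i \<in> {1, 2, 3, 4, 5, 6, 7, 8, 9, 10, 11, 12, 13, 14, 15, 16, 17, 18, 19, 20, 21, 22}"
      by (simp add: atLeastAtMost_iff) presburger
    then show "s (fst (klein_exp i)) (snd (klein_exp i)) = 0"
      by (elim insertE) (simp_all only: klein_exp_simps fst_conv snd_conv z empty_iff)
  qed
qed

end

section \<open>Moments at rational points of the curve\<close>

text \<open>Moments inherit every identity that holds at all points: x^8 = x gives
  \<open>X8\<close>, x^7 y = y gives \<open>X7\<close>, and the curve equation times x^a y^(b-3)
  gives \<open>Y3\<close>.\<close>

lemma klein_moments_moment:
  fixes P :: "'n::finite \<Rightarrow> 'a::{field,finite} \<times> 'a"
  assumes "CARD('a) = 8" and "range P \<subseteq> klein_zeros"
  shows "klein_moments (moment P c)"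
proof
  have cyc: "x ^ 8 = x" for x :: 'a
    using power_CARD_eq_same[of x] assms(1) by simp
  have x8: "x ^ a = x ^ (a - 7)" if "8 \<le> a" for x :: 'a and a
  proof -
    have "x ^ a = x ^ 8 * x ^ (a - 8)" using that by (simp flip: power_add)
    also have "\<dots> = x ^ Suc (a - 8)" by (simp add: cyc)
    also have "Suc (a - 8) = a - 7" using that by simp
    finally show ?thesis .
  qed
  have zero: "snd (P p) ^ 3 + fst (P p) ^ 3 * snd (P p) + fst (P p) = 0" for p
  proof -
    have "P p \<in> klein_zeros" using assms(2) by blast
    then show ?thesis
      by (simp add: klein_zeros_def eval2_def klein_quartic_def varX_def varY_def ac_simps)
  qed
  show "moment P c a b = moment P c (a - 7) b" if "8 \<le> a" for a b
    by (simp add: moment_def x8[OF that])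
  show "moment P c a b = moment P c (a - 7) b" if "7 \<le> a" "1 \<le> b" for a b
  proof (cases "a = 7")
    case True
    have "fst (P p) ^ 7 * snd (P p) ^ b = snd (P p) ^ b" for p
    \<comment> \<open>If x = 0, the curve equation forces y = 0, and both sides vanish because b is
      at least 1. At the origin the identity would fail for b = 0.\<close>
    proof (cases "fst (P p) = 0")
      case True
      with zero[of p] have "snd (P p) = 0" by simp
      with that show ?thesis by simp
    next
      case False
      have "fst (P p) * fst (P p) ^ 7 = fst (P p)"
        using cyc[of "fst (P p)"] by (simp flip: power_Suc)
      with False show ?thesis by simp
    qed
    with True show ?thesis by (simp only: moment_def diff_self_eq_0 power_0 mult_1)
  qed (use that in \<open>simp add: moment_def x8\<close>)
  show "moment P c a b = - moment P c (a + 3) (b - 2) - moment P c (a + 1) (b - 3)" if "3 \<le> b" for a b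
  proof -
    obtain d where d: "b = d + 3" using \<open>3 \<le> b\<close> by (metis add.commute le_Suc_ex)
    have "fst (P p) ^ a * snd (P p) ^ b + fst (P p) ^ (a + 3) * snd (P p) ^ (b - 2)
      + fst (P p) ^ (a + 1) * snd (P p) ^ (b - 3)
      = fst (P p) ^ a * snd (P p) ^ d * (snd (P p) ^ 3 + fst (P p) ^ 3 * snd (P p) + fst (P p))" for p
      by (simp add: d power_add algebra_simps)
    then have "moment P c a b + moment P c (a + 3) (b - 2) + moment P c (a + 1) (b - 3) = 0"
      by (simp add: moment_def zero flip: sum.distrib distrib_left)
    then show ?thesis by (simp add: eq_neg_iff_add_eq_0 algebra_simps)
  qed
qed

text \<open>By linearity \<open>c\<close> is orthogonal to the values of every product q(X) r(Y).
  Lagrange polynomials for the two coordinates of \<open>P p\<close> give a product that, as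
  \<open>P\<close> is injective, is nonzero only at \<open>p\<close>, which isolates
  \<open>c $ p\<close>.\<close>

lemma moment_eq_0_imp:
  fixes P :: "'n::finite \<Rightarrow> 'a::{field,finite} \<times> 'a"
  assumes "inj P" and "\<And>a b. moment P c a b = 0"
  shows "c = 0"
proof -
  have eq: "(\<Sum>p\<in>UNIV. c $ p * (poly q (fst (P p)) * poly r (snd (P p)))) = 0" for q r
  proof -
    have "(\<Sum>p\<in>UNIV. c $ p * (poly q (fst (P p)) * poly r (snd (P p))))
      = (\<Sum>p\<in>UNIV. \<Sum>i\<le>degree q. \<Sum>j\<le>degree r.
          coeff q i * coeff r j * (c $ p * (fst (P p) ^ i * snd (P p) ^ j)))"
      unfolding poly_altdef sum_product by (simp add: sum_distrib_left mult_ac)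
    also have "\<dots> = (\<Sum>i\<le>degree q. \<Sum>j\<le>degree r. coeff q i * coeff r j * moment P c i j)"
      unfolding moment_def sum_distrib_left
      by (subst sum.swap, rule sum.cong[OF refl], subst sum.swap) (rule refl)
    finally show ?thesis by (simp add: assms(2))
  qed
  have "c $ p = 0" for p
  proof -
    define l where "l u = (\<Prod>v\<in>UNIV-{u}. [:- v, 1:])" for u :: 'a
    have l: "poly (l u) v = 0 \<longleftrightarrow> v \<noteq> u" for u v
      by (auto simp: l_def poly_prod)
    have other: "poly (l (fst (P p))) (fst (P p')) * poly (l (snd (P p))) (snd (P p')) = 0" if "p' \<noteq> p" for p'
    proof -
      have "P p' \<noteq> P p" using that assms(1) by (auto dest: injD)
      then show ?thesis by (auto simp: l prod_eq_iff)
    qed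
    have "(\<Sum>p'\<in>UNIV. c $ p' * (poly (l (fst (P p))) (fst (P p')) * poly (l (snd (P p))) (snd (P p'))))
      = (\<Sum>p'\<in>{p}. c $ p' * (poly (l (fst (P p))) (fst (P p')) * poly (l (snd (P p))) (snd (P p'))))"
      by (rule sum.mono_neutral_right) (use other in auto)
    then show ?thesis by (simp add: eq) (simp add: l)
  qed
  then show ?thesis by (simp add: vec_eq_iff)
qed

section \<open>Parity checks, weight, dimension and distance of the code\<close>

definition klein_syndrome ::
    "('n \<Rightarrow> 'a::field \<times> 'a) \<Rightarrow> 'a ^ 'n \<Rightarrow> nat \<Rightarrow> 'a" where
  "klein_syndrome P c i = moment P c (fst (klein_exp i)) (snd (klein_exp i))"

lemma mem_klein_code_iff:
  "c \<in> klein_code P \<delta> \<longleftrightarrow> (\<forall>i\<in>{1..22}. klein_mu i < \<delta> \<longrightarrow> klein_syndrome P c i = 0)"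
proof -
  have eq: "scalar_product c (ev P (klein_monomial i)) = klein_syndrome P c i" for i
    by (simp add: scalar_product_def ev_def eval2_klein_monomial klein_syndrome_def moment_def)
  let ?S = "{ev P (klein_monomial i) | i. i \<in> {1..22} \<and> klein_mu i < \<delta>}"
  have "c \<in> klein_code P \<delta> \<longleftrightarrow> (\<forall>w\<in>vec.span ?S. scalar_product c w = 0)"
    by (simp only: klein_code_def dual_code_def mem_Collect_eq)
  also have "\<dots> \<longleftrightarrow> (\<forall>w\<in>?S. scalar_product c w = 0)"
    by (meson scalar_product_span_eq_0 vec.span_base)
  also have "\<dots> \<longleftrightarrow> (\<forall>i\<in>{1..22}. klein_mu i < \<delta> \<longrightarrow> klein_syndrome P c i = 0)"
    unfolding eq[symmetric] by blast
  finally show ?thesis .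
qed

lemma subspace_dual_code: "vec.subspace (dual_code C)"
  by (rule vec.subspaceI)
    (auto simp: dual_code_def scalar_product_add_left scalar_product_scale_left,
      simp add: scalar_product_def)

text \<open>Every nonzero syndrome of a codeword has \<open>klein_mu i\<close> at least \<delta>. A
  weight below \<delta> would thus make every staircase shorter than each such
  \<open>klein_mu i\<close>, so all moments, and with them \<open>c\<close>, would vanish.\<close>

lemma klein_code_weight_ge:
  fixes P :: "'n::finite \<Rightarrow> 'a::{field,finite} \<times> 'a"
  assumes "CARD('a) = 8" "range P \<subseteq> klein_zeros" "inj P"
    and c: "c \<in> klein_code P \<delta>" "c \<noteq> 0"
  shows "\<delta> \<le> card {p. c $ p \<noteq> 0}"
proof (rule ccontr)
  assume less: "\<not> \<delta> \<le> card {p. c $ p \<noteq> 0}"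
  interpret klein_moments "moment P c"
    using assms by (intro klein_moments_moment)
  have "moment P c a b = 0" for a b
  proof (rule eq_0_if_staircases_short)
    fix i :: nat and L
    assume i: "i \<in> {1..22}" "moment P c (fst (klein_exp i)) (snd (klein_exp i)) \<noteq> 0"
      and L: "staircase (at_product (moment P c)) L"
    \<comment> \<open>Evaluation is multiplicative, which brings the matrix into the factored form
      of the rank bound.\<close>
    have eq: "at_product (moment P c) = (\<lambda>j k. \<Sum>p\<in>UNIV. c $ p *
        (ev P (klein_monomial j) $ p * ev P (klein_monomial k) $ p))"
      by (intro ext)
        (simp add: at_product_def moment_def ev_def eval2_klein_monomial power_add ac_simps)
    have "length L \<le> card {p. c $ p \<noteq> 0}"
      using L unfolding eq by (rule length_le_card_support_if_staircase)
    then show "length L < klein_mu i"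
      using c(1) i less by (force simp: mem_klein_code_iff klein_syndrome_def)
  qed
  then show False
    using moment_eq_0_imp assms by metis
qed

text \<open>The map \<open>T\<close> to the 22 syndromes is an injective endomorphism of a
  finite-dimensional space, hence bijective. It carries the code onto a coordinate subspace, whose
  dimension is a count of free coordinates.\<close>

lemma dim_klein_code:
  fixes P :: "22 \<Rightarrow> 'a::{field,finite} \<times> 'a"
  assumes "CARD('a) = 8" "range P \<subseteq> klein_zeros" "inj P"
  shows "vec.dim (klein_code P \<delta>) = card {i \<in> {1..22}. \<delta> \<le> klein_mu i}"
proof -
  \<comment> \<open>\<open>e\<close> matches the coordinates, indexed by the type \<open>22\<close>,
    with the monomial numbers 1 to 22.\<close>
  obtain e where e: "bij_betw e (UNIV :: 22 set) {1..22::nat}"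
    using finite_same_card_bij[of "UNIV :: 22 set" "{1..22::nat}"] by auto
  then have e_range: "range e = {1..22}"
    by (rule bij_betw_imp_surj_on)
  define T where "T c = (\<chi> j. klein_syndrome P c (e j))" for c
  have lin: "Vector_Spaces.linear (*s) (*s) T"
    by unfold_locales
      (auto simp: T_def vec_eq_iff klein_syndrome_def moment_def sum.distrib sum_distrib_left
        distrib_right mult.assoc)
  have "c = 0" if "T c = 0" for c
  proof -
    interpret klein_moments "moment P c"
      using assms by (intro klein_moments_moment)
    have "klein_syndrome P c (e j) = 0" for j
      using \<open>T c = 0\<close> by (simp add: T_def vec_eq_iff)
    then have "klein_syndrome P c i = 0" if "i \<in> {1..22}" for i
      using that e_range by (metis imageE)
    then have "moment P c a b = 0" for a b
      unfolding klein_syndrome_def by (rule eq_0_if_klein_exp_eq_0)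
    with assms(3) show ?thesis by (rule moment_eq_0_imp)
  qed
  then have inj: "inj T"
    using vec.linear_inj_iff_eq_0[OF lin] by blast
  then have surj: "surj T"
    using vec.linear_injective_imp_surjective[OF lin] by blast
  define d where "d = {j. \<delta> \<le> klein_mu (e j)}"
  have "c \<in> klein_code P \<delta> \<longleftrightarrow>
      (\<forall>j. klein_mu (e j) < \<delta> \<longrightarrow> klein_syndrome P c (e j) = 0)" for c
    unfolding mem_klein_code_iff e_range[symmetric] by simp
  then have code: "klein_code P \<delta> = T -` {x. \<forall>j. j \<notin> d \<longrightarrow> x $ j = 0}"
    by (auto simp: d_def T_def not_le)
  have "vec.dim (klein_code P \<delta>) = vec.dim (T ` klein_code P \<delta>)"
    using vec.dim_image_eq[OF lin] inj inj_on_subset by (metis subset_UNIV)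
  also have "T ` klein_code P \<delta> = {x. \<forall>j. j \<notin> d \<longrightarrow> x $ j = 0}"
    unfolding code using surj by (rule surj_image_vimage_eq)
  also have "vec.dim \<dots> = card d"
    by (rule dim_substandard_cart)
  also have "card d = card (e ` d)"
    using e by (simp add: card_image bij_betw_def inj_on_subset[of e UNIV])
  also have "e ` d = {i \<in> {1..22}. \<delta> \<le> klein_mu i}"
    unfolding e_range[symmetric] by (auto simp: d_def)
  finally show ?thesis .
qed

lemma le_min_distance:
  assumes "vec.subspace C" "vec.dim C \<noteq> 0"
    and "\<And>c. c \<in> C \<Longrightarrow> c \<noteq> 0 \<Longrightarrow> \<delta> \<le> card {p. c $ p \<noteq> 0}"
  shows "\<delta> \<le> min_distance C"
  unfolding min_distance_def
proof (rule cInf_greatest)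
  \<comment> \<open>A trivial code would have the default minimum distance 0; nonzero dimension
    supplies two distinct words.\<close>
  have "\<not> C \<subseteq> {0}"
    using assms(2) vec.dim_subset[of C "{0}"] by auto
  then show "{hamming_dist v w |v w. v \<in> C \<and> w \<in> C \<and> v \<noteq> w} \<noteq> {}"
    using vec.subspace_0[OF assms(1)] by auto
next
  fix d assume "d \<in> {hamming_dist v w |v w. v \<in> C \<and> w \<in> C \<and> v \<noteq> w}"
  then obtain v w where "d = hamming_dist v w" "v \<in> C" "w \<in> C" "v \<noteq> w"
    by blast
  then show "\<delta> \<le> d"
    using assms(3)[of "v - w"] vec.subspace_diff[OF assms(1)] by (simp add: hamming_dist_def)
qed

theorem mainTheorem7:
  fixes P :: "22 \<Rightarrow> 'a::{field,finite} \<times> 'a"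
  assumes "CARD('a) = 8"
    and "bij_betw P UNIV klein_zeros"
  shows "\<forall>(k, \<delta>) \<in> {(21,2), (19,3), (17,4), (15,6), (12,8), (10,9), (9,11), (8,12),
            (6,14), (5,15), (3,17), (2,18), (1,21)}.
          vec.subspace (klein_code P \<delta>) \<and>
          vec.dim (klein_code P \<delta>) = k \<and>
          min_distance (klein_code P \<delta>) \<ge> \<delta>"
proof -
  have P: "range P \<subseteq> klein_zeros" "inj P"
    using assms(2) by (auto simp: bij_betw_def)
  have sub: "vec.subspace (klein_code P \<delta>)" for \<delta>
    unfolding klein_code_def by (rule subspace_dual_code)
  have code: "vec.subspace (klein_code P \<delta>) \<and> vec.dim (klein_code P \<delta>) = k \<and>
      min_distance (klein_code P \<delta>) \<ge> \<delta>"
    if "card {i \<in> {1..22}. \<delta> \<le> klein_mu i} = k" "k \<noteq> 0" for k \<delta>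
    using that sub dim_klein_code[OF assms(1) P] klein_code_weight_ge[OF assms(1) P]
    by (intro conjI le_min_distance) auto
  \<comment> \<open>As the length of a filtered list, the dimension can be computed by
    rewriting.\<close>
  have card: "card {i \<in> {1..22}. \<delta> \<le> klein_mu i} =
      length (filter (\<lambda>i. \<delta> \<le> klein_mu i) [1..<23])" for \<delta>
  proof -
    have "{i \<in> {1..22}. \<delta> \<le> klein_mu i} = set (filter (\<lambda>i. \<delta> \<le> klein_mu i) [1..<23])"
      by auto
    then show ?thesis
      by (simp only: distinct_card distinct_filter distinct_upt)
  qed
  show ?thesis
    by (intro ballI, elim insertE emptyE)
      ((simp only: prod.case, rule code, subst card, simp add: klein_mu_def upt_rec, simp)+)
qed

end
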